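(* Assume CH. Every nonprincipal neighborhood filter in $\beta\omega$ is cofinally equivalent to a neighborhood filter in $\beta\omega\setminus\omega$; that is, for every nonprincipal ultrafilter $\mathcal{U}$ on $\omega$ there is $p\in\beta\omega\setminus\omega$ such that $\mathrm{Nbhd}(\mathcal{U},\beta\omega)$ is cofinally equivalent to $\mathrm{Nbhd}(p,\beta\omega\setminus\omega)$.
   Context: $\beta\omega$ is identified with the space of ultrafilters on $\omega$, and $\beta\omega\setminus\omega$ with the subspace of nonprincipal ultrafilters. $\mathrm{Nbhd}(p,X)$ is the set of all $U\subseteq X$ such that $p$ is in the interior of $U$, preordered by containment $\supseteq$ (smaller neighborhoods are greater). Preorders $P$ and $Q$ are cofinally equivalent if there is a preorder $R$ such that $P$ and $Q$ are order isomorphic to cofinal subsets of $R$. *)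

theory Defs
  imports "HOL-Analysis.Analysis"
begin

unbundle cardinal_syntax

text \<open>The continuum hypothesis in the form that the power set of \<open>\<omega>\<close> has cardinality
  \<open>\<aleph>\<^sub>1\<close>.\<close>

definition CH :: bool where
  "CH \<longleftrightarrow> |UNIV :: nat set set| =o cardSuc natLeq"

text \<open>A set \<open>A\<close> belongs to the filter \<open>F\<close> when \<open>eventually (\<lambda>x. x \<in> A) F\<close> holds; the
  type of filters contains the improper filter \<open>bot\<close>.\<close>

definition ultrafilter :: "'a filter \<Rightarrow> bool" where
  "ultrafilter F \<longleftrightarrow> F \<noteq> bot \<and> (\<forall>P. eventually P F \<or> eventually (\<lambda>x. \<not> P x) F)"

definition nonprincipal :: "'a filter \<Rightarrow> bool" where
  "nonprincipal F \<longleftrightarrow> (\<forall>a. F \<noteq> principal {a})"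

definition stone_basic :: "nat set \<Rightarrow> nat filter set" where
  "stone_basic A = {F. ultrafilter F \<and> eventually (\<lambda>n. n \<in> A) F}"

definition beta_omega :: "nat filter topology" where
  "beta_omega = topology_generated_by (range stone_basic)"

definition omega_star :: "nat filter topology" where
  "omega_star = subtopology beta_omega {F. nonprincipal F}"

lemma topspace_beta_omega: "topspace beta_omega = {F. ultrafilter F}"
proof
  show "topspace beta_omega \<subseteq> {F. ultrafilter F}"
    by (auto simp: beta_omega_def topology_generated_by_topspace stone_basic_def)
  have "{F. ultrafilter F} = stone_basic UNIV" by (simp add: stone_basic_def)
  then show "{F. ultrafilter F} \<subseteq> topspace beta_omega"
    by (auto simp: beta_omega_def topology_generated_by_topspace)
qed

lemma topspace_omega_star: "topspace omega_star = {F. ultrafilter F \<and> nonprincipal F}"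
  by (auto simp: omega_star_def topspace_beta_omega)

definition Nbhd :: "'a \<Rightarrow> 'a topology \<Rightarrow> 'a set set" where
  "Nbhd p X = {U. U \<subseteq> topspace X \<and> p \<in> X interior_of U}"

text \<open>Preorders are reflexive transitive relations on their field; a pair \<open>(x, y)\<close> in
  such a relation means that \<open>x\<close> is below \<open>y\<close>.\<close>

definition nbhd_order :: "'a \<Rightarrow> 'a topology \<Rightarrow> 'a set rel" where
  "nbhd_order p X = {(U, V). U \<in> Nbhd p X \<and> V \<in> Nbhd p X \<and> U \<supseteq> V}"

lemma Field_nbhd_order: "Field (nbhd_order p X) = Nbhd p X"
  by (auto simp: nbhd_order_def Field_def)

lemma Preorder_nbhd_order: "Preorder (nbhd_order p X)"
  unfolding preorder_on_def Field_nbhd_order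
  by (auto simp: nbhd_order_def refl_on_def trans_def)

text \<open>The constant \<^const>\<open>cofinal\<close> of the cardinals library asks for strictly larger elements
  and is therefore not used here.\<close>

definition cofinal_subset :: "'a set \<Rightarrow> 'a rel \<Rightarrow> bool" where
  "cofinal_subset C R \<longleftrightarrow> C \<subseteq> Field R \<and> (\<forall>x\<in>Field R. \<exists>c\<in>C. (x, c) \<in> R)"

definition order_isomorphic :: "'a rel \<Rightarrow> 'b rel \<Rightarrow> bool" where
  "order_isomorphic P Q \<longleftrightarrow>
     (\<exists>f. bij_betw f (Field P) (Field Q) \<and>
          (\<forall>x\<in>Field P. \<forall>y\<in>Field P. (x, y) \<in> P \<longleftrightarrow> (f x, f y) \<in> Q))"

text \<open>The preorder \<open>R\<close> is sought on the sum of the two types, since a definition cannot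
  quantify over types. By \<open>cofinally_equivalentI\<close> below, this is no restriction.\<close>

definition cofinally_equivalent :: "'a rel \<Rightarrow> 'b rel \<Rightarrow> bool" where
  "cofinally_equivalent P Q \<longleftrightarrow>
     (\<exists>R :: ('a + 'b) rel. Preorder R \<and>
        (\<exists>C. cofinal_subset C R \<and> order_isomorphic P (Restr R C)) \<and>
        (\<exists>D. cofinal_subset D R \<and> order_isomorphic Q (Restr R D)))"

lemma Field_Restr_Preorder: "Preorder R \<Longrightarrow> C \<subseteq> Field R \<Longrightarrow> Field (Restr R C) = C"
  by (auto simp: preorder_on_def refl_on_def Field_def)

lemma cofinally_equivalentI:
  fixes P :: "'a rel" and Q :: "'b rel" and R :: "'c rel"
  assumes R: "Preorder R"
    and C: "cofinal_subset C R" "order_isomorphic P (Restr R C)"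
    and D: "cofinal_subset D R" "order_isomorphic Q (Restr R D)"
  shows "cofinally_equivalent P Q"
proof -
  have FC: "Field (Restr R C) = C" and FD: "Field (Restr R D) = D"
    using R C(1) D(1) Field_Restr_Preorder unfolding cofinal_subset_def by blast+
  obtain f where f: "bij_betw f (Field P) C"
      "\<And>x y. x \<in> Field P \<Longrightarrow> y \<in> Field P \<Longrightarrow> (x, y) \<in> P \<longleftrightarrow> (f x, f y) \<in> Restr R C"
    using C(2) unfolding order_isomorphic_def FC by blast
  obtain g where g: "bij_betw g (Field Q) D"
      "\<And>x y. x \<in> Field Q \<Longrightarrow> y \<in> Field Q \<Longrightarrow> (x, y) \<in> Q \<longleftrightarrow> (g x, g y) \<in> Restr R D"
    using D(2) unfolding order_isomorphic_def FD by blast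
  define h where "h = case_sum f g"
  define E where "E = Inl ` Field P \<union> Inr ` Field Q"
  define S where "S = {(u, v). u \<in> E \<and> v \<in> E \<and> (h u, h v) \<in> R}"
  have fC: "f x \<in> C" if "x \<in> Field P" for x using f(1) that by (auto simp: bij_betw_def)
  have gD: "g x \<in> D" if "x \<in> Field Q" for x using g(1) that by (auto simp: bij_betw_def)
  have hR: "h u \<in> Field R" if "u \<in> E" for u
    using that fC gD C(1) D(1) unfolding E_def h_def cofinal_subset_def by auto
  have reflR: "(z, z) \<in> R" if "z \<in> Field R" for z
    using R that by (auto simp: preorder_on_def refl_on_def)
  have transR: "trans R" using R by (simp add: preorder_on_def)
  have hrefl: "(u, u) \<in> S" if "u \<in> E" for u
    using reflR[OF hR[OF that]] that by (simp add: S_def)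
  have FS: "Field S = E"
  proof
    show "Field S \<subseteq> E" by (auto simp: Field_def S_def)
    show "E \<subseteq> Field S" using hrefl by (auto intro: FieldI1)
  qed
  have S: "Preorder S"
    unfolding preorder_on_def FS
  proof (intro conjI)
    show "S \<subseteq> E \<times> E" by (auto simp: S_def)
    show "refl_on E S" using hrefl by (simp add: refl_on_def)
    show "trans S" using transR unfolding S_def trans_def by blast
  qed
  have cof1: "cofinal_subset (Inl ` Field P) S"
    unfolding cofinal_subset_def FS
  proof (intro conjI ballI)
    show "Inl ` Field P \<subseteq> E" by (auto simp: E_def)
    fix u assume u: "u \<in> E"
    then obtain c where "c \<in> C" "(h u, c) \<in> R" using C(1) hR unfolding cofinal_subset_def by blast
    moreover then obtain x where "x \<in> Field P" "f x = c" using f(1) unfolding bij_betw_def by blast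
    ultimately show "\<exists>c\<in>Inl ` Field P. (u, c) \<in> S"
      using u by (auto simp: S_def h_def E_def)
  qed
  have cof2: "cofinal_subset (Inr ` Field Q) S"
    unfolding cofinal_subset_def FS
  proof (intro conjI ballI)
    show "Inr ` Field Q \<subseteq> E" by (auto simp: E_def)
    fix u assume u: "u \<in> E"
    then obtain c where "c \<in> D" "(h u, c) \<in> R" using D(1) hR unfolding cofinal_subset_def by blast
    moreover then obtain x where "x \<in> Field Q" "g x = c" using g(1) unfolding bij_betw_def by blast
    ultimately show "\<exists>c\<in>Inr ` Field Q. (u, c) \<in> S"
      using u by (auto simp: S_def h_def E_def)
  qed
  have F1: "Field (Restr S (Inl ` Field P)) = Inl ` Field P"
    and F2: "Field (Restr S (Inr ` Field Q)) = Inr ` Field Q"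
    using Field_Restr_Preorder[OF S] cof1 cof2 unfolding cofinal_subset_def by meson+
  have iso1: "order_isomorphic P (Restr S (Inl ` Field P))"
    unfolding order_isomorphic_def F1
  proof (intro exI[of _ Inl] conjI ballI)
    show "bij_betw Inl (Field P) (Inl ` Field P)" by (simp add: bij_betw_def)
    fix x y assume xy: "x \<in> Field P" "y \<in> Field P"
    show "(x, y) \<in> P \<longleftrightarrow> (Inl x, Inl y) \<in> Restr S (Inl ` Field P)"
      using f(2)[OF xy] fC[OF xy(1)] fC[OF xy(2)] xy by (simp add: S_def h_def E_def)
  qed
  have iso2: "order_isomorphic Q (Restr S (Inr ` Field Q))"
    unfolding order_isomorphic_def F2
  proof (intro exI[of _ Inr] conjI ballI)
    show "bij_betw Inr (Field Q) (Inr ` Field Q)" by (simp add: bij_betw_def)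
    fix x y assume xy: "x \<in> Field Q" "y \<in> Field Q"
    show "(x, y) \<in> Q \<longleftrightarrow> (Inr x, Inr y) \<in> Restr S (Inr ` Field Q)"
      using g(2)[OF xy] gD[OF xy(1)] gD[OF xy(2)] xy by (simp add: S_def h_def E_def)
  qed
  show ?thesis
    unfolding cofinally_equivalent_def using S cof1 cof2 iso1 iso2 by blast
qed

end

theory Submission
  imports Defs "HOL-Library.Countable_Set_Type"
begin

text \<open>Two directed preorders are cofinally equivalent as soon as each is Tukey reducible to the
  other (\<open>tukey_equivalent_imp_cofinally_equivalent\<close>), so a nonprincipal ultrafilter \<open>p\<close> is
  needed such that \<open>\<U>\<close> ordered by \<open>\<supseteq>\<close> and \<open>p\<close> ordered by almost inclusion \<open>\<supseteq>\<^sup>*\<close> reduce to each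
  other: sets of the ultrafilter stand for neighbourhoods in \<open>\<beta>\<omega>\<close>, and two clopen subsets of
  \<open>\<omega>\<^sup>*\<close> are nested when the underlying sets are nested up to a finite set.

  CH provides a P-point \<open>d\<close>. Let \<open>p\<close> be the \<open>\<U>\<close>-sum of copies of \<open>d\<close> on the columns of
  \<open>\<omega> \<times> \<omega>\<close>: a set belongs to \<open>p\<close> when \<open>\<U>\<close>-almost all of its columns belong to \<open>d\<close>.

  The map \<open>A \<mapsto> A \<times> \<omega>\<close> reduces \<open>\<U>\<close> to \<open>p\<close>: if \<open>B \<in> p\<close> is almost contained in \<open>A \<times> \<omega>\<close>, then \<open>A\<close>
  contains every \<open>n\<close> for which the column of \<open>B\<close> belongs to \<open>d\<close>, since such a column is infinite;
  and the set of these \<open>n\<close> lies in \<open>\<U>\<close>.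

  For the converse, let \<open>\<C>\<close> be the filter of sets all of whose columns belong to \<open>d\<close>. Every
  \<open>B \<in> p\<close> contains \<open>C \<inter> (S \<times> \<omega>)\<close> for some \<open>S \<in> \<U>\<close> and \<open>C \<in> \<C>\<close>, so \<open>p\<close> reduces to the product of
  \<open>\<U>\<close> and \<open>\<C>\<close>, and it is enough to reduce \<open>\<C>\<close>, ordered by \<open>\<supseteq>\<^sup>*\<close>, to \<open>\<U>\<close>. As \<open>d\<close> is a P-point,
  countable subsets of \<open>\<C>\<close> are bounded (\<open>column_filter_countably_directed\<close>), whereas no countable
  subset of \<open>\<U>\<close> is cofinal (\<open>nonprincipal_ultrafilter_no_countable_base\<close>). Under CH both orders
  have at most \<open>\<aleph>\<^sub>1\<close> elements, and then these two properties yield a reduction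
  (\<open>tukey_below_of_countable_segments\<close>).\<close>

section \<open>Ultrafilters\<close>

lemma ultrafilter_eventually_not:
  assumes "ultrafilter F"
  shows "eventually (\<lambda>x. \<not> P x) F \<longleftrightarrow> \<not> eventually P F"
proof
  assume 1: "eventually (\<lambda>x. \<not> P x) F"
  show "\<not> eventually P F"
  proof
    assume "eventually P F"
    with 1 have "eventually (\<lambda>x. False) F" by eventually_elim simp
    then show False using assms by (simp add: ultrafilter_def trivial_limit_def)
  qed
next
  assume "\<not> eventually P F"
  then show "eventually (\<lambda>x. \<not> P x) F" using assms by (auto simp: ultrafilter_def)
qed

lemma ultrafilter_principal: "ultrafilter (principal {a})"
  by (auto simp: ultrafilter_def eventually_principal principal_eq_bot_iff)

lemma nonprincipal_ultrafilter_iff: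
  assumes "ultrafilter F"
  shows "nonprincipal F \<longleftrightarrow> (\<forall>a. eventually (\<lambda>x. x \<noteq> a) F)"
proof
  assume np: "nonprincipal F"
  show "\<forall>a. eventually (\<lambda>x. x \<noteq> a) F"
  proof (intro allI, rule ccontr)
    fix a
    assume "\<not> eventually (\<lambda>x. x \<noteq> a) F"
    then have ev: "eventually (\<lambda>x. x = a) F"
      using ultrafilter_eventually_not[OF assms, of "\<lambda>x. x = a"] by simp
    have "eventually P F \<longleftrightarrow> P a" for P
    proof
      assume "eventually P F"
      with ev have "eventually (\<lambda>x. P a) F" by eventually_elim simp
      then show "P a"
        using assms by (cases "P a") (auto simp: ultrafilter_def trivial_limit_def)
    next
      assume "P a"
      then show "eventually P F" using ev by (auto elim: eventually_mono)
    qed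
    then have "F = principal {a}" by (simp add: filter_eq_iff eventually_principal)
    then show False using np by (simp add: nonprincipal_def)
  qed
next
  assume *: "\<forall>a. eventually (\<lambda>x. x \<noteq> a) F"
  show "nonprincipal F"
    unfolding nonprincipal_def
  proof (intro allI notI)
    fix a assume "F = principal {a}"
    then show False using *[rule_format, of a] by (simp add: eventually_principal)
  qed
qed

lemma nonprincipal_ultrafilter_mod_finite:
  assumes "ultrafilter F" "nonprincipal F" "eventually (\<lambda>x. x \<in> A) F" "finite (A - B)"
  shows "eventually (\<lambda>x. x \<in> B) F"
proof -
  have "eventually (\<lambda>x. \<forall>a\<in>A - B. x \<noteq> a) F"
    using assms by (intro eventually_ball_finite) (auto simp: nonprincipal_ultrafilter_iff)
  with assms(3) show ?thesis by eventually_elim auto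
qed

lemma nonprincipal_ultrafilter_infinite:
  assumes "ultrafilter F" "nonprincipal F" "eventually (\<lambda>x. x \<in> A) F"
  shows "infinite A"
proof
  assume "finite A"
  then have "eventually (\<lambda>x. x \<in> {}) F"
    using nonprincipal_ultrafilter_mod_finite[OF assms, of "{}"] by simp
  then show False using assms(1) by (simp add: ultrafilter_def trivial_limit_def)
qed

text \<open>A countable family of infinite sets has room for two disjoint sets that both meet
  every member. The ultrafilter contains the complement of one of them, and this complement includes
  no member of the family.\<close>

lemma nonprincipal_ultrafilter_no_countable_base:
  fixes F :: "'a filter"
  assumes F: "ultrafilter F" "nonprincipal F"
    and S: "countable S" "\<And>A. A \<in> S \<Longrightarrow> eventually (\<lambda>x. x \<in> A) F"
  shows "\<exists>B. eventually (\<lambda>x. x \<in> B) F \<and> (\<forall>A\<in>S. \<not> A \<subseteq> B)"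
proof (cases "S = {}")
  case True
  then show ?thesis by (intro exI[of _ UNIV]) simp
next
  case False
  define Y where "Y = from_nat_into S"
  have Y: "infinite (Y k)" for k
    using nonprincipal_ultrafilter_infinite[OF F S(2)] from_nat_into[OF False] by (simp add: Y_def)
  \<comment> \<open>Index \<open>k\<close> serves the set \<open>Y (k div 2)\<close>, so that each set receives one point of even and one
    of odd index.\<close>
  have "\<exists>x. x \<in> Y (k div 2) \<and> x \<notin> f ` {..<k}" for k :: nat and f :: "nat \<Rightarrow> 'a"
  proof -
    have "infinite (Y (k div 2) - f ` {..<k})" using Y by (intro Diff_infinite_finite) auto
    then show ?thesis by (metis Diff_iff finite.emptyI equals0I)
  qed
  then have "\<exists>f :: nat \<Rightarrow> 'a. \<forall>k. f k \<in> Y (k div 2) \<and> f k \<notin> f ` {..<k}"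
    by (intro dependent_wf_choice[OF wf_less_than, simplified]) (auto simp: image_iff)
  then obtain f :: "nat \<Rightarrow> 'a" where f: "\<And>k. f k \<in> Y (k div 2)" "\<And>k. f k \<notin> f ` {..<k}"
    by blast
  have inj: "f i \<noteq> f j" if "i \<noteq> j" for i j
    using that f(2)[of i] f(2)[of j] by (metis imageI lessThan_iff linorder_neqE_nat)
  define E where "E = (\<lambda>k. f (2 * k)) ` UNIV"
  define D where "D = (\<lambda>k. f (2 * k + 1)) ` UNIV"
  have "f (2 * k) \<noteq> f (2 * l + 1)" for k l by (rule inj) presburger
  then have disj: "E \<inter> D = {}" by (auto simp: E_def D_def)
  have E: "\<not> A \<subseteq> - E" and D: "\<not> A \<subseteq> - D" if A: "A \<in> S" for A
  proof -
    obtain k where k: "A = Y k" using from_nat_into_surj[OF S(1) A] by (auto simp: Y_def)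
    show "\<not> A \<subseteq> - E" using f(1)[of "2 * k"] by (auto simp: k E_def)
    show "\<not> A \<subseteq> - D" using f(1)[of "2 * k + 1"] by (auto simp: k D_def)
  qed
  show ?thesis
  proof (cases "eventually (\<lambda>x. x \<in> - E) F")
    case True
    then show ?thesis using E by blast
  next
    case False
    then have "eventually (\<lambda>x. x \<in> E) F"
      using ultrafilter_eventually_not[OF F(1), of "\<lambda>x. x \<in> E"] by simp
    then have "eventually (\<lambda>x. x \<in> - D) F" by eventually_elim (use disj in auto)
    then show ?thesis using D by blast
  qed
qed

section \<open>P-points under the continuum hypothesis\<close>

text \<open>The cardinal order of the power set of \<open>\<omega>\<close> serves: its proper initial segments have
  cardinality below \<open>\<aleph>\<^sub>1\<close>.\<close>

lemma CH_well_order_countable_segments: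
  assumes CH
  obtains r :: "nat set rel"
  where "wf (r - Id)" and "\<And>X Y. (X, Y) \<in> r \<or> (Y, X) \<in> r"
    and "\<And>X. countable {Y. (Y, X) \<in> r}"
proof
  let ?r = "|UNIV :: nat set set|"
  have wo: "well_order_on UNIV ?r" by (rule card_of_well_order_on)
  then show "wf (?r - Id)" by (simp add: well_order_on_def)
  show "(X, Y) \<in> ?r \<or> (Y, X) \<in> ?r" for X Y
    using wo unfolding well_order_on_def linear_order_on_def partial_order_on_def
      preorder_on_def refl_on_def total_on_def by (cases "X = Y") auto
  fix X
  have "|underS ?r X| <o ?r" by (intro card_of_underS card_of_Card_order) (simp add: Field_card_of)
  then have "|underS ?r X| <o cardSuc natLeq"
    using assms ordLess_ordIso_trans unfolding CH_def by blast
  then have "countable (underS ?r X)"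
    using cardSuc_ordLeq_ordLess[OF natLeq_Card_order card_of_Card_order, of "underS ?r X"]
    by (simp add: countable_card_le_natLeq)
  moreover have "{Y. (Y, X) \<in> ?r} \<subseteq> insert X (underS ?r X)" by (auto simp: underS_def)
  ultimately show "countable {Y. (Y, X) \<in> ?r}" by (meson countable_insert countable_subset)
qed

text \<open>Diagonalization: the \<open>k\<close>-th point is chosen in the intersection of the first \<open>k + 1\<close>
  sets of an enumeration.\<close>

lemma infinite_pseudointersection:
  fixes S :: "nat set set"
  assumes "countable S" and fin: "\<And>T. T \<subseteq> S \<Longrightarrow> finite T \<Longrightarrow> infinite (\<Inter>T)"
  obtains Z where "infinite Z" and "\<And>A. A \<in> S \<Longrightarrow> finite (Z - A)"
proof (cases "S = {}")
  case True
  then show ?thesis using that[of UNIV] by simp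
next
  case False
  define Y where "Y = from_nat_into S"
  define D where "D k = (\<Inter>i\<le>k. Y i)" for k
  have D: "infinite (D k)" for k
    unfolding D_def using from_nat_into[OF False] by (intro fin) (auto simp: Y_def)
  have "\<exists>z. \<forall>k. z k \<in> D k \<and> z k < z (Suc k)"
  proof (rule dependent_nat_choice)
    show "\<exists>x. x \<in> D 0" using D[of 0] by (metis finite.emptyI equals0I)
    show "\<exists>y. y \<in> D (Suc k) \<and> x < y" for x k
      using D[of "Suc k"] unfolding infinite_nat_iff_unbounded by blast
  qed
  then obtain z where z: "\<And>k. z k \<in> D k" "\<And>k. z k < z (Suc k)" by blast
  have mono: "strict_mono z" using z(2) by (simp add: strict_mono_Suc_iff)
  show ?thesis
  proof (rule that)
    show "infinite (range z)"
      using mono by (intro range_inj_infinite strict_mono_imp_inj_on)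
    fix A assume "A \<in> S"
    then obtain k where k: "A = Y k" using from_nat_into_surj[OF assms(1)] by (auto simp: Y_def)
    have "range z - A \<subseteq> z ` {..<k}"
    proof
      fix x assume "x \<in> range z - A"
      then obtain i where i: "x = z i" "z i \<notin> A" by auto
      have "i < k"
      proof (rule ccontr)
        assume "\<not> i < k"
        then have "z i \<in> A" using z(1)[of i] by (auto simp: D_def k)
        then show False using i by simp
      qed
      then show "x \<in> z ` {..<k}" using i by simp
    qed
    then show "finite (range z - A)" by (rule finite_subset) simp
  qed
qed

text \<open>A nonempty finite chain under almost inclusion has a least member, and all but finitely
  many points of it lie in the intersection.\<close>

lemma almost_chain_finite_infinite_Inter:
  assumes "finite T" and inf: "\<And>A. A \<in> T \<Longrightarrow> infinite A" and "infinite (UNIV :: 'a set)"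
    and chain: "\<And>A B. A \<in> T \<Longrightarrow> B \<in> T \<Longrightarrow> finite (A - B) \<or> finite (B - A)"
  shows "infinite (\<Inter>T :: 'a set)"
proof (cases "T = {}")
  case True
  then show ?thesis using assms(3) by simp
next
  case False
  have "\<exists>A\<in>T. \<forall>B\<in>T. finite (A - B)"
    using assms(1) False chain
  proof (induction T rule: finite_ne_induct)
    case (singleton x)
    then show ?case by simp
  next
    case (insert x T)
    then obtain A where A: "A \<in> T" "\<forall>B\<in>T. finite (A - B)" by blast
    consider "finite (A - x)" | "finite (x - A)" using insert.prems A(1) by blast
    then show ?case
    proof cases
      case 1
      then show ?thesis using A by blast
    next
      case 2
      have "finite (x - B)" if "B \<in> T" for B
      proof (rule finite_subset)
        show "x - B \<subseteq> (x - A) \<union> (A - B)" by blast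
        show "finite ((x - A) \<union> (A - B))" using 2 A(2) that by simp
      qed
      then show ?thesis by auto
    qed
  qed
  then obtain A where A: "A \<in> T" "\<forall>B\<in>T. finite (A - B)" by blast
  have "A \<subseteq> \<Inter>T \<union> (\<Union>B\<in>T. A - B)" by blast
  moreover have "finite (\<Union>B\<in>T. A - B)" using A assms(1) by blast
  ultimately show ?thesis using inf[OF A(1)] by (meson finite_UnI finite_subset)
qed

text \<open>The sets \<open>T X\<close> are chosen by recursion along a well-order with countable initial segments.
  Those chosen before \<open>X\<close> form a countable chain under almost inclusion, which has an infinite
  pseudointersection; one of its two parts inside and outside of \<open>X\<close> is still infinite. Deciding
  every \<open>X\<close> in this way is what makes the filter generated by the tower an ultrafilter.\<close>

lemma CH_tower:
  assumes CH
  obtains r and T :: "nat set \<Rightarrow> nat set"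
  where "\<And>X Y. (X, Y) \<in> r \<or> (Y, X) \<in> r" and "\<And>X. countable {Y. (Y, X) \<in> r}"
    and "\<And>X. infinite (T X)" and "\<And>X. T X \<subseteq> X \<or> T X \<inter> X = {}"
    and "\<And>X Y. (Y, X) \<in> r \<Longrightarrow> finite (T X - T Y)"
proof -
  obtain r :: "nat set rel" where wo: "wf (r - Id)"
    and tot: "\<And>X Y. (X, Y) \<in> r \<or> (Y, X) \<in> r"
    and cs: "\<And>X. countable {Y. (Y, X) \<in> r}"
    using CH_well_order_countable_segments[OF assms] by blast
  define P where "P f X Z \<longleftrightarrow> infinite Z \<and> (Z \<subseteq> X \<or> Z \<inter> X = {}) \<and>
      (\<forall>Y. (Y, X) \<in> r - Id \<longrightarrow> finite (Z - f Y))" for f :: "nat set \<Rightarrow> nat set" and X Z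
  have "\<exists>f. \<forall>X. P f X (f X)"
  proof (rule dependent_wf_choice)
    show "wf (r - Id)" by (rule wo)
    show "P f X Z = P g X Z" if "\<And>Y. (Y, X) \<in> r - Id \<Longrightarrow> f Y = g Y" for f g X Z
      using that by (auto simp: P_def)
    fix X and f :: "nat set \<Rightarrow> nat set"
    assume IH: "\<And>Y. (Y, X) \<in> r - Id \<Longrightarrow> P f Y (f Y)"
    define S where "S = f ` {Y. (Y, X) \<in> r - Id}"
    have "countable {Y. (Y, X) \<in> r - Id}" by (rule countable_subset[OF _ cs[of X]]) auto
    then have "countable S" by (simp add: S_def)
    moreover have "infinite (\<Inter>Q)" if "Q \<subseteq> S" "finite Q" for Q
    proof (rule almost_chain_finite_infinite_Inter)
      show "infinite A" if "A \<in> Q" for A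
        using that \<open>Q \<subseteq> S\<close> IH by (auto simp: S_def P_def)
      fix A B assume "A \<in> Q" "B \<in> Q"
      then have "A \<in> S" "B \<in> S" using \<open>Q \<subseteq> S\<close> by auto
      from \<open>A \<in> S\<close> obtain a where a: "(a, X) \<in> r - Id" "A = f a" unfolding S_def by blast
      from \<open>B \<in> S\<close> obtain b where b: "(b, X) \<in> r - Id" "B = f b" unfolding S_def by blast
      from a b show "finite (A - B) \<or> finite (B - A)"
        using tot[of a b] IH[of a] IH[of b] by (cases "a = b") (auto simp: P_def)
    qed (use that in auto)
    ultimately obtain Z where Z: "infinite Z" "\<And>A. A \<in> S \<Longrightarrow> finite (Z - A)"
      using infinite_pseudointersection by metis
    define W where "W = (if infinite (Z \<inter> X) then Z \<inter> X else Z - X)"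
    have "infinite W" using Z(1) by (auto simp: W_def) (metis Int_Diff_Un finite_UnI)
    moreover have "finite (W - f Y)" if "(Y, X) \<in> r - Id" for Y
    proof (rule finite_subset)
      show "W - f Y \<subseteq> Z - f Y" by (auto simp: W_def)
      show "finite (Z - f Y)" using that by (intro Z) (auto simp: S_def)
    qed
    moreover have "W \<subseteq> X \<or> W \<inter> X = {}" by (auto simp: W_def)
    ultimately show "\<exists>W. P f X W" by (auto simp: P_def)
  qed
  then obtain T where T: "\<And>X. P T X (T X)" by blast
  show ?thesis
  proof (rule that[OF tot cs])
    fix X
    show "infinite (T X)" "T X \<subseteq> X \<or> T X \<inter> X = {}" using T by (auto simp: P_def)
    fix Y assume "(Y, X) \<in> r"
    then show "finite (T X - T Y)" using T[of X] by (cases "X = Y") (auto simp: P_def)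
  qed
qed

definition p_point :: "'a filter \<Rightarrow> bool" where
  "p_point F \<longleftrightarrow> ultrafilter F \<and> nonprincipal F \<and>
     (\<forall>S. countable S \<and> (\<forall>A\<in>S. eventually (\<lambda>x. x \<in> A) F) \<longrightarrow>
        (\<exists>Z. eventually (\<lambda>x. x \<in> Z) F \<and> (\<forall>A\<in>S. finite (Z - A))))"

lemma p_pointD:
  assumes "p_point F" "countable S" "\<And>A. A \<in> S \<Longrightarrow> eventually (\<lambda>x. x \<in> A) F"
  shows "\<exists>Z. eventually (\<lambda>x. x \<in> Z) F \<and> (\<forall>A\<in>S. finite (Z - A))"
  using assms unfolding p_point_def by blast

text \<open>The filter generated by a tower of length \<open>\<omega>\<^sub>1\<close> that decides every set. Countably many
  members of this filter are controlled by countably many stages of the tower, and these stages are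
  bounded, since their initial segments cannot cover the uncountable index set.\<close>

lemma CH_p_point_exists:
  assumes CH
  obtains d :: "nat filter" where "p_point d"
proof -
  obtain r and T :: "nat set \<Rightarrow> nat set" where tot: "\<And>X Y. (X, Y) \<in> r \<or> (Y, X) \<in> r"
    and cs: "\<And>X. countable {Y. (Y, X) \<in> r}"
    and T: "\<And>X. infinite (T X)" "\<And>X. T X \<subseteq> X \<or> T X \<inter> X = {}"
      "\<And>X Y. (Y, X) \<in> r \<Longrightarrow> finite (T X - T Y)"
    using CH_tower[OF assms] by blast
  have bound: "\<exists>X. \<forall>Y\<in>S. finite (T X - T Y)" if "countable S" for S
  proof -
    have "countable (\<Union>Y\<in>S. {X. (X, Y) \<in> r})" using that cs by blast
    moreover have "\<not> countable (UNIV :: nat set set)"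
    proof
      assume "countable (UNIV :: nat set set)"
      then have "|UNIV :: nat set set| \<le>o natLeq" by (simp add: countable_card_le_natLeq)
      moreover have "natLeq <o |UNIV :: nat set set|"
        using assms cardSuc_greater[OF natLeq_Card_order] ordLess_ordIso_trans ordIso_symmetric
        unfolding CH_def by blast
      ultimately show False using not_ordLess_ordLeq by blast
    qed
    ultimately obtain X where "X \<notin> (\<Union>Y\<in>S. {X. (X, Y) \<in> r})" by (metis UNIV_eq_I)
    then have "(Y, X) \<in> r" if "Y \<in> S" for Y using tot[of X Y] that by blast
    then show ?thesis using T(3) by blast
  qed
  define d where "d = Abs_filter (\<lambda>P. \<exists>X. finite (T X - Collect P))"
  have ev: "eventually P d \<longleftrightarrow> (\<exists>X. finite (T X - Collect P))" for P
    unfolding d_def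
  proof (rule eventually_Abs_filter, rule is_filter.intro)
    show "\<exists>X. finite (T X - Collect (\<lambda>x. True))" by simp
    fix P Q :: "nat \<Rightarrow> bool"
    assume "\<exists>X. finite (T X - Collect P)" "\<exists>X. finite (T X - Collect Q)"
    then obtain X Y where XY: "finite (T X - Collect P)" "finite (T Y - Collect Q)" by blast
    obtain Z where Z: "finite (T Z - T X)" "finite (T Z - T Y)" using bound[of "{X, Y}"] by auto
    have "finite (T Z - Collect (\<lambda>x. P x \<and> Q x))"
    proof (rule finite_subset)
      show "T Z - Collect (\<lambda>x. P x \<and> Q x) \<subseteq>
          (T Z - T X) \<union> (T Z - T Y) \<union> (T X - Collect P) \<union> (T Y - Collect Q)" by blast
    qed (use XY Z in simp)
    then show "\<exists>X. finite (T X - Collect (\<lambda>x. P x \<and> Q x))" ..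
  next
    fix P Q :: "nat \<Rightarrow> bool"
    assume "\<forall>x. P x \<longrightarrow> Q x" "\<exists>X. finite (T X - Collect P)"
    then obtain X where "finite (T X - Collect P)" by blast
    then have "finite (T X - Collect Q)"
      by (rule finite_subset[rotated]) (use \<open>\<forall>x. P x \<longrightarrow> Q x\<close> in auto)
    then show "\<exists>X. finite (T X - Collect Q)" ..
  qed
  have uf: "ultrafilter d"
    unfolding ultrafilter_def
  proof (intro conjI allI)
    show "d \<noteq> bot" using T(1) by (simp add: trivial_limit_def ev)
    fix P :: "nat \<Rightarrow> bool"
    show "eventually P d \<or> eventually (\<lambda>x. \<not> P x) d"
    proof (cases "T (Collect P) \<subseteq> Collect P")
      case True
      then have "T (Collect P) - Collect P = {}" by blast
      then show ?thesis unfolding ev by (metis finite.emptyI)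
    next
      case False
      then have "T (Collect P) - Collect (\<lambda>x. \<not> P x) = {}" using T(2)[of "Collect P"] by blast
      then show ?thesis unfolding ev by (metis finite.emptyI)
    qed
  qed
  have "nonprincipal d"
    unfolding nonprincipal_ultrafilter_iff[OF uf] ev by (auto simp: Collect_neg_eq)
  moreover have "\<exists>Z. eventually (\<lambda>x. x \<in> Z) d \<and> (\<forall>A\<in>S. finite (Z - A))"
    if S: "countable S" "\<forall>A\<in>S. eventually (\<lambda>x. x \<in> A) d" for S
  proof -
    from S(2) have "\<forall>A\<in>S. \<exists>X. finite (T X - A)" by (simp add: ev)
    then obtain X where X: "\<And>A. A \<in> S \<Longrightarrow> finite (T (X A) - A)" by metis
    obtain Y where Y: "\<And>A. A \<in> S \<Longrightarrow> finite (T Y - T (X A))"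
      using bound[of "X ` S"] S(1) by auto
    have "finite (T Y - A)" if "A \<in> S" for A
    proof (rule finite_subset)
      show "T Y - A \<subseteq> (T Y - T (X A)) \<union> (T (X A) - A)" by blast
    qed (use X Y that in simp)
    moreover have "eventually (\<lambda>x. x \<in> T Y) d" unfolding ev by (intro exI[of _ Y]) simp
    ultimately show ?thesis by blast
  qed
  ultimately have "p_point d" using uf unfolding p_point_def by blast
  then show ?thesis by (rule that)
qed

section \<open>Tukey reductions\<close>

text \<open>Tukey reducibility, in the form that preimages of bounded sets are bounded.\<close>

definition tukey_below :: "'a rel \<Rightarrow> 'b rel \<Rightarrow> bool" where
  "tukey_below P Q \<longleftrightarrow>
     (\<exists>f. (\<forall>x\<in>Field P. f x \<in> Field Q) \<and>
        (\<forall>y\<in>Field Q. \<exists>b\<in>Field P. \<forall>x\<in>Field P. (f x, y) \<in> Q \<longrightarrow> (x, b) \<in> P))"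

definition directed :: "'a rel \<Rightarrow> bool" where
  "directed P \<longleftrightarrow> (\<forall>x\<in>Field P. \<forall>y\<in>Field P. \<exists>z\<in>Field P. (x, z) \<in> P \<and> (y, z) \<in> P)"

text \<open>The two reductions can be enlarged, by directedness, to maps \<open>f\<close> and \<open>g\<close> such that
  \<open>f x \<le> y\<close> implies \<open>x \<le> g y\<close> and \<open>g y \<le> x\<close> implies \<open>y \<le> f x\<close>. On the disjoint union, put \<open>x\<close> below
  \<open>y\<close> if \<open>f x' \<le> y\<close> for some \<open>x' \<ge> x\<close>, and symmetrically. The two implications say that passing
  to the other side and back creates no new relations, so this is a preorder that extends both given
  ones, and \<open>f\<close> and \<open>g\<close> witness that both sides are cofinal.\<close>

lemma tukey_equivalent_imp_cofinally_equivalent: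
  assumes P: "Preorder P" "directed P" and Q: "Preorder Q" "directed Q"
    and PQ: "tukey_below P Q" and QP: "tukey_below Q P"
  shows "cofinally_equivalent P Q"
proof -
  have reflP: "(x, x) \<in> P" if "x \<in> Field P" for x
    using P(1) that by (auto simp: preorder_on_def refl_on_def)
  have reflQ: "(x, x) \<in> Q" if "x \<in> Field Q" for x
    using Q(1) that by (auto simp: preorder_on_def refl_on_def)
  have transP: "(x, z) \<in> P" if "(x, y) \<in> P" "(y, z) \<in> P" for x y z
    using P(1) that unfolding preorder_on_def trans_def by blast
  have transQ: "(x, z) \<in> Q" if "(x, y) \<in> Q" "(y, z) \<in> Q" for x y z
    using Q(1) that unfolding preorder_on_def trans_def by blast
  obtain f0 where f0: "\<And>x. x \<in> Field P \<Longrightarrow> f0 x \<in> Field Q"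
    "\<forall>y\<in>Field Q. \<exists>b\<in>Field P. \<forall>x\<in>Field P. (f0 x, y) \<in> Q \<longrightarrow> (x, b) \<in> P"
    using PQ unfolding tukey_below_def by blast
  obtain g' where g': "\<And>y. y \<in> Field Q \<Longrightarrow> g' y \<in> Field P"
    "\<And>x y. y \<in> Field Q \<Longrightarrow> x \<in> Field P \<Longrightarrow> (f0 x, y) \<in> Q \<Longrightarrow> (x, g' y) \<in> P"
    using f0(2) by metis
  obtain g0 where g0: "\<And>y. y \<in> Field Q \<Longrightarrow> g0 y \<in> Field P"
    "\<forall>x\<in>Field P. \<exists>b\<in>Field Q. \<forall>y\<in>Field Q. (g0 y, x) \<in> P \<longrightarrow> (y, b) \<in> Q"
    using QP unfolding tukey_below_def by blast
  obtain f' where f': "\<And>x. x \<in> Field P \<Longrightarrow> f' x \<in> Field Q"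
    "\<And>x y. y \<in> Field Q \<Longrightarrow> x \<in> Field P \<Longrightarrow> (g0 y, x) \<in> P \<Longrightarrow> (y, f' x) \<in> Q"
    using g0(2) by metis
  \<comment> \<open>The reduction \<open>f0\<close> gives \<open>f\<close> the first implication and the bounds \<open>f'\<close> supplied by the
    opposite reduction \<open>g0\<close> give it the second one, so \<open>f\<close> has to lie above both.\<close>
  have "\<forall>x\<in>Field P. \<exists>z\<in>Field Q. (f0 x, z) \<in> Q \<and> (f' x, z) \<in> Q"
    using Q(2) f0(1) f'(1) unfolding directed_def by blast
  then obtain f where f: "\<And>x. x \<in> Field P \<Longrightarrow> f x \<in> Field Q"
    "\<And>x. x \<in> Field P \<Longrightarrow> (f0 x, f x) \<in> Q" "\<And>x. x \<in> Field P \<Longrightarrow> (f' x, f x) \<in> Q" by metis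
  have "\<forall>y\<in>Field Q. \<exists>z\<in>Field P. (g0 y, z) \<in> P \<and> (g' y, z) \<in> P"
    using P(2) g0(1) g'(1) unfolding directed_def by blast
  then obtain g where g: "\<And>y. y \<in> Field Q \<Longrightarrow> g y \<in> Field P"
    "\<And>y. y \<in> Field Q \<Longrightarrow> (g0 y, g y) \<in> P" "\<And>y. y \<in> Field Q \<Longrightarrow> (g' y, g y) \<in> P" by metis
  have fg: "(x, g y) \<in> P" if "x \<in> Field P" "y \<in> Field Q" "(f x, y) \<in> Q" for x y
    using that f(2) g'(2) g(3) transP transQ by meson
  have gf: "(y, f x) \<in> Q" if "x \<in> Field P" "y \<in> Field Q" "(g y, x) \<in> P" for x y
    using that g(2) f'(2) f(3) transP transQ by meson
  define R where "R = {(Inl x, Inl x') | x x'. (x, x') \<in> P} \<union> {(Inr y, Inr y') | y y'. (y, y') \<in> Q}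
    \<union> {(Inl x, Inr y) | x y. \<exists>x'. (x, x') \<in> P \<and> (f x', y) \<in> Q}
    \<union> {(Inr y, Inl x) | x y. \<exists>y'. (y, y') \<in> Q \<and> (g y', x) \<in> P}"
  have R: "(Inl x, Inl x') \<in> R \<longleftrightarrow> (x, x') \<in> P" "(Inr y, Inr y') \<in> R \<longleftrightarrow> (y, y') \<in> Q"
    "(Inl x, Inr y) \<in> R \<longleftrightarrow> (\<exists>x'. (x, x') \<in> P \<and> (f x', y) \<in> Q)"
    "(Inr y, Inl x) \<in> R \<longleftrightarrow> (\<exists>y'. (y, y') \<in> Q \<and> (g y', x) \<in> P)" for x x' y y'
    by (auto simp: R_def)
  have FR: "Field R = Inl ` Field P \<union> Inr ` Field Q"
  proof
    show "Field R \<subseteq> Inl ` Field P \<union> Inr ` Field Q"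
      unfolding R_def Field_def by auto
    show "Inl ` Field P \<union> Inr ` Field Q \<subseteq> Field R"
      using reflP reflQ by (blast intro: FieldI1 R(1)[THEN iffD2] R(2)[THEN iffD2])
  qed
  have trans: "trans R"
  proof (rule transI)
    fix u v w assume uv: "(u, v) \<in> R" and vw: "(v, w) \<in> R"
    show "(u, w) \<in> R"
    proof (cases u; cases v; cases w)
      fix x y x' assume c: "u = Inl x" "v = Inr y" "w = Inl x'"
      then obtain a b where a: "(x, a) \<in> P" "(f a, y) \<in> Q" and b: "(y, b) \<in> Q" "(g b, x') \<in> P"
        using uv vw unfolding c R by blast
      have "(a, g b) \<in> P" using a b by (meson fg transQ FieldI2)
      then show ?thesis using a b c R(1) transP by meson
    next
      fix y x y' assume c: "u = Inr y" "v = Inl x" "w = Inr y'"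
      then obtain a b where a: "(y, a) \<in> Q" "(g a, x) \<in> P" and b: "(x, b) \<in> P" "(f b, y') \<in> Q"
        using uv vw unfolding c R by blast
      have "(a, f b) \<in> Q" using a b by (meson gf transP FieldI2)
      then show ?thesis using a b c R(2) transQ by meson
    qed (use uv vw in \<open>simp_all only: R\<close>, (meson transP transQ)+)
  qed
  have refl: "(u, u) \<in> R" if "u \<in> Field R" for u
    using that reflP reflQ R(1,2) unfolding FR by auto
  have pre: "Preorder R"
    unfolding preorder_on_def refl_on_def using trans refl by (auto intro: FieldI1 FieldI2)
  have "(Inr y, Inl (g y)) \<in> R" if "y \<in> Field Q" for y
    using R(4) that reflQ reflP g(1) by meson
  then have cofP: "cofinal_subset (Inl ` Field P) R"
    unfolding cofinal_subset_def FR using g(1) by (blast intro: reflP R(1)[THEN iffD2])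
  have "(Inl x, Inr (f x)) \<in> R" if "x \<in> Field P" for x
    using R(3) that reflQ reflP f(1) by meson
  then have cofQ: "cofinal_subset (Inr ` Field Q) R"
    unfolding cofinal_subset_def FR using f(1) by (blast intro: reflQ R(2)[THEN iffD2])
  have FP: "Field (Restr R (Inl ` Field P)) = Inl ` Field P"
    and FQ: "Field (Restr R (Inr ` Field Q)) = Inr ` Field Q"
    using Field_Restr_Preorder[OF pre] cofP cofQ unfolding cofinal_subset_def by meson+
  have "order_isomorphic P (Restr R (Inl ` Field P))"
    unfolding order_isomorphic_def FP
    by (intro exI[of _ Inl]) (auto simp: bij_betw_def R)
  moreover have "order_isomorphic Q (Restr R (Inr ` Field Q))"
    unfolding order_isomorphic_def FQ
    by (intro exI[of _ Inr]) (auto simp: bij_betw_def R)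
  ultimately show ?thesis
    unfolding cofinally_equivalent_def using pre cofP cofQ by blast
qed

text \<open>Send \<open>x\<close> to an element \<open>f x\<close> of \<open>Q\<close> that lies below none of the countably many elements
  preceding \<open>x\<close> in \<open>r\<close>. If \<open>f x\<close> is below \<open>y\<close>, then \<open>y\<close> does not precede \<open>x\<close>, so that \<open>x\<close> is one of
  the countably many predecessors of \<open>y\<close>, and these have a common bound in \<open>P\<close>.\<close>

lemma tukey_below_of_countable_segments:
  fixes P Q r :: "'a rel"
  assumes tot: "\<And>x y. (x, y) \<in> r \<or> (y, x) \<in> r" and cs: "\<And>x. countable {y. (y, x) \<in> r}"
    and P: "\<And>S. S \<subseteq> Field P \<Longrightarrow> countable S \<Longrightarrow> \<exists>b\<in>Field P. \<forall>x\<in>S. (x, b) \<in> P"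
    and Q: "\<And>S. S \<subseteq> Field Q \<Longrightarrow> countable S \<Longrightarrow> \<exists>y\<in>Field Q. \<forall>s\<in>S. (y, s) \<notin> Q"
  shows "tukey_below P Q"
proof -
  have "\<exists>y\<in>Field Q. \<forall>s\<in>Field Q. (s, x) \<in> r \<longrightarrow> (y, s) \<notin> Q" for x
  proof -
    have "countable {s \<in> Field Q. (s, x) \<in> r}" by (rule countable_subset[OF _ cs[of x]]) auto
    then show ?thesis using Q[of "{s \<in> Field Q. (s, x) \<in> r}"] by blast
  qed
  then obtain f where f: "\<And>x. f x \<in> Field Q"
    "\<And>x s. s \<in> Field Q \<Longrightarrow> (s, x) \<in> r \<Longrightarrow> (f x, s) \<notin> Q" by metis
  have "\<exists>b\<in>Field P. \<forall>x\<in>Field P. (f x, y) \<in> Q \<longrightarrow> (x, b) \<in> P" if "y \<in> Field Q" for y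
  proof -
    have "{x \<in> Field P. (f x, y) \<in> Q} \<subseteq> {x. (x, y) \<in> r}"
      using f(2)[OF that] tot by blast
    then have "countable {x \<in> Field P. (f x, y) \<in> Q}" using cs countable_subset by blast
    then show ?thesis using P[of "{x \<in> Field P. (f x, y) \<in> Q}"] by blast
  qed
  then show ?thesis unfolding tukey_below_def using f(1) by blast
qed

section \<open>Neighbourhoods\<close>

lemma stone_basic_Int: "stone_basic A \<inter> stone_basic B = stone_basic (A \<inter> B)"
  by (auto simp: stone_basic_def eventually_conj_iff)

text \<open>Principal ultrafilters separate subsets of \<open>\<omega>\<close>.\<close>

lemma stone_basic_subset_iff: "stone_basic A \<subseteq> stone_basic B \<longleftrightarrow> A \<subseteq> B"
proof
  assume *: "stone_basic A \<subseteq> stone_basic B"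
  show "A \<subseteq> B"
  proof
    fix a assume "a \<in> A"
    then have "principal {a} \<in> stone_basic A"
      by (simp add: stone_basic_def ultrafilter_principal eventually_principal)
    then have "principal {a} \<in> stone_basic B" using * by blast
    then show "a \<in> B" by (simp add: stone_basic_def eventually_principal)
  qed
qed (auto simp: stone_basic_def elim: eventually_mono)

lemma openin_stone_basic: "openin beta_omega (stone_basic A)"
  unfolding beta_omega_def by (intro topology_generated_by_Basis) simp

lemma openin_beta_omega_stone_basic:
  assumes "openin beta_omega V" "F \<in> V"
  shows "\<exists>A. F \<in> stone_basic A \<and> stone_basic A \<subseteq> V"
proof -
  have "generate_topology_on (range stone_basic) V"
    using assms(1) by (simp add: beta_omega_def openin_topology_generated_by_iff)
  then show ?thesis using assms(2)
  proof (induction rule: generate_topology_on.induct)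
    case (Int a b)
    then obtain A B where "F \<in> stone_basic A" "stone_basic A \<subseteq> a"
      "F \<in> stone_basic B" "stone_basic B \<subseteq> b" by auto
    then show ?case using stone_basic_Int[of A B] by (intro exI[of _ "A \<inter> B"]) blast
  next
    case (UN K)
    then show ?case by (meson UnionE Union_upper order_trans)
  qed auto
qed

lemma Nbhd_beta_omega:
  "N \<in> Nbhd F beta_omega \<longleftrightarrow>
    N \<subseteq> topspace beta_omega \<and> (\<exists>A. F \<in> stone_basic A \<and> stone_basic A \<subseteq> N)"
  unfolding Nbhd_def interior_of_def mem_Collect_eq
  using openin_beta_omega_stone_basic openin_stone_basic by (meson order_trans)

lemma Nbhd_omega_star:
  assumes "nonprincipal F"
  shows "N \<in> Nbhd F omega_star \<longleftrightarrow> N \<subseteq> topspace omega_star \<and>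
    (\<exists>A. F \<in> stone_basic A \<and> stone_basic A \<inter> Collect nonprincipal \<subseteq> N)"
    (is "_ \<longleftrightarrow> _ \<and> ?E")
proof -
  have "(\<exists>V. openin omega_star V \<and> F \<in> V \<and> V \<subseteq> N) \<longleftrightarrow> ?E"
  proof
    assume "\<exists>V. openin omega_star V \<and> F \<in> V \<and> V \<subseteq> N"
    then obtain W where W: "openin beta_omega W" "F \<in> W" "W \<inter> Collect nonprincipal \<subseteq> N"
      by (auto simp: omega_star_def openin_subtopology)
    then show ?E using openin_beta_omega_stone_basic[OF W(1,2)] by blast
  next
    assume ?E
    then show "\<exists>V. openin omega_star V \<and> F \<in> V \<and> V \<subseteq> N"
      using openin_stone_basic assms unfolding omega_star_def openin_subtopology by blast
  qed
  then show ?thesis by (simp add: Nbhd_def interior_of_def)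
qed

lemma stone_basic_in_Nbhd_beta_omega:
  "F \<in> stone_basic A \<Longrightarrow> stone_basic A \<in> Nbhd F beta_omega"
  unfolding Nbhd_beta_omega topspace_beta_omega by (auto simp: stone_basic_def)

lemma stone_basic_in_Nbhd_omega_star:
  assumes "nonprincipal F" "F \<in> stone_basic A"
  shows "stone_basic A \<inter> Collect nonprincipal \<in> Nbhd F omega_star"
  unfolding Nbhd_omega_star[OF assms(1)] topspace_omega_star
  using assms(2) by (auto simp: stone_basic_def)

lemma directed_nbhd_order: "directed (nbhd_order p X)"
  unfolding directed_def Field_nbhd_order
proof (intro ballI)
  fix U V assume "U \<in> Nbhd p X" "V \<in> Nbhd p X"
  then have "U \<inter> V \<in> Nbhd p X" by (auto simp: Nbhd_def interior_of_Int)
  then show "\<exists>W\<in>Nbhd p X. (U, W) \<in> nbhd_order p X \<and> (V, W) \<in> nbhd_order p X"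
    using \<open>U \<in> Nbhd p X\<close> \<open>V \<in> Nbhd p X\<close>
    by (intro bexI[of _ "U \<inter> V"]) (auto simp: nbhd_order_def)
qed

section \<open>Sums of ultrafilters along the columns\<close>

definition column :: "nat set \<Rightarrow> nat \<Rightarrow> nat set" where
  "column A n = {m. prod_encode (n, m) \<in> A}"

text \<open>The sum (Fubini product) of ultrafilters, on \<open>\<omega>\<close> instead of \<open>\<omega> \<times> \<omega>\<close> because the points of
  \<open>\<beta>\<omega>\<close> are filters on \<open>\<omega>\<close>.\<close>

definition fubini :: "nat filter \<Rightarrow> nat filter \<Rightarrow> nat filter" where
  "fubini F G = Abs_filter (\<lambda>P. eventually (\<lambda>n. eventually (\<lambda>m. P (prod_encode (n, m))) G) F)"

lemma eventually_fubini:
  "eventually P (fubini F G) \<longleftrightarrow> eventually (\<lambda>n. eventually (\<lambda>m. P (prod_encode (n, m))) G) F"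
  unfolding fubini_def
proof (rule eventually_Abs_filter, rule is_filter.intro)
  fix P Q :: "nat \<Rightarrow> bool"
  assume "eventually (\<lambda>n. eventually (\<lambda>m. P (prod_encode (n, m))) G) F"
    "eventually (\<lambda>n. eventually (\<lambda>m. Q (prod_encode (n, m))) G) F"
  then show "eventually (\<lambda>n. eventually (\<lambda>m. P (prod_encode (n, m)) \<and> Q (prod_encode (n, m))) G) F"
    by eventually_elim (rule eventually_conj)
next
  fix P Q :: "nat \<Rightarrow> bool"
  assume "\<forall>x. P x \<longrightarrow> Q x" "eventually (\<lambda>n. eventually (\<lambda>m. P (prod_encode (n, m))) G) F"
  then show "eventually (\<lambda>n. eventually (\<lambda>m. Q (prod_encode (n, m))) G) F"
    by (auto elim!: eventually_mono)
qed simp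

lemma fubini_mem:
  "eventually (\<lambda>x. x \<in> A) (fubini F G) \<longleftrightarrow> eventually (\<lambda>n. eventually (\<lambda>m. m \<in> column A n) G) F"
  by (simp add: eventually_fubini column_def)

lemma ultrafilter_fubini:
  assumes "ultrafilter F" "ultrafilter G"
  shows "ultrafilter (fubini F G)"
  unfolding ultrafilter_def
proof (intro conjI allI)
  show "fubini F G \<noteq> bot"
    using assms by (simp add: trivial_limit_def eventually_fubini ultrafilter_def)
  show "eventually P (fubini F G) \<or> eventually (\<lambda>x. \<not> P x) (fubini F G)" for P
    unfolding eventually_fubini ultrafilter_eventually_not[OF assms(2)]
      ultrafilter_eventually_not[OF assms(1)] by blast
qed

lemma nonprincipal_fubini:
  assumes "ultrafilter F" "ultrafilter G" "nonprincipal G"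
  shows "nonprincipal (fubini F G)"
  unfolding nonprincipal_ultrafilter_iff[OF ultrafilter_fubini[OF assms(1,2)]] eventually_fubini
proof (rule allI, rule always_eventually, rule allI)
  fix a n
  have "eventually (\<lambda>m. m \<noteq> snd (prod_decode a)) G"
    using assms nonprincipal_ultrafilter_iff by blast
  then show "eventually (\<lambda>m. prod_encode (n, m) \<noteq> a) G"
    by eventually_elim (metis prod_encode_inverse snd_conv)
qed

text \<open>Let \<open>Z \<in> d\<close> be almost contained in all columns of all the given sets \<open>C\<^sub>0, C\<^sub>1, \<dots>\<close>, and
  intersect \<open>Z\<close> in column \<open>n\<close> with the columns of \<open>C\<^sub>0, \<dots>, C\<^sub>n\<close>. The resulting set can leave \<open>C\<^sub>k\<close>
  only in the columns below \<open>k\<close>, and there only in finitely many points each.\<close>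

lemma column_filter_countably_directed:
  assumes d: "p_point d"
    and S: "countable S" "\<And>C n. C \<in> S \<Longrightarrow> eventually (\<lambda>m. m \<in> column C n) d"
  shows "\<exists>D. (\<forall>n. eventually (\<lambda>m. m \<in> column D n) d) \<and> (\<forall>C\<in>S. finite (D - C))"
proof (cases "S = {}")
  case True
  then show ?thesis by (intro exI[of _ UNIV]) (simp add: column_def)
next
  case False
  define C where "C = from_nat_into S"
  have C: "eventually (\<lambda>m. m \<in> column (C k) n) d" for k n
    using S(2) from_nat_into[OF False] by (simp add: C_def)
  have "countable (range (\<lambda>(k, n). column (C k) n))" by simp
  then obtain Z where Z: "eventually (\<lambda>m. m \<in> Z) d" "\<And>k n. finite (Z - column (C k) n)"
    using p_pointD[OF d, of "range (\<lambda>(k, n). column (C k) n)"] C by fastforce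
  define D where "D = prod_encode ` {(n, m). m \<in> Z \<and> (\<forall>k\<le>n. m \<in> column (C k) n)}"
  have col: "column D n = {m. m \<in> Z \<and> (\<forall>k\<le>n. m \<in> column (C k) n)}" for n
    unfolding D_def column_def[of "prod_encode ` _"] by (auto simp: inj_image_mem_iff[OF inj_prod_encode])
  have "eventually (\<lambda>m. m \<in> column D n) d" for n
  proof -
    have "eventually (\<lambda>m. \<forall>k\<in>{..n}. m \<in> column (C k) n) d"
      by (rule eventually_ball_finite) (use C in auto)
    with Z(1) show ?thesis by eventually_elim (auto simp: col)
  qed
  moreover have "finite (D - A)" if A: "A \<in> S" for A
  proof -
    obtain k where k: "A = C k" using from_nat_into_surj[OF S(1) A] by (auto simp: C_def)
    have "D - A \<subseteq> prod_encode ` (SIGMA n:{..<k}. Z - column (C k) n)"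
    proof
      fix x assume x: "x \<in> D - A"
      then obtain n m where nm: "x = prod_encode (n, m)" "m \<in> Z" "\<forall>k\<le>n. m \<in> column (C k) n"
        by (auto simp: D_def)
      moreover have "m \<notin> column (C k) n" using x nm(1) by (simp add: k column_def)
      ultimately have "n < k" by (meson not_le)
      then show "x \<in> prod_encode ` (SIGMA n:{..<k}. Z - column (C k) n)"
        using nm \<open>m \<notin> column (C k) n\<close> by blast
    qed
    then show ?thesis by (rule finite_subset) (use Z(2) in auto)
  qed
  ultimately show ?thesis by blast
qed

section \<open>The two reductions\<close>

text \<open>The reduction is \<open>A \<mapsto> A \<times> \<omega>\<close>. The ultrafilter that witnesses \<open>n \<in> A\<close> is the copy of \<open>d\<close> on
  column \<open>n\<close>, which is the sum along the principal ultrafilter of \<open>n\<close>: it is a point of \<open>\<omega>\<^sup>*\<close>, so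
  inclusion of neighbourhoods there can be tested at it.\<close>

lemma tukey_below_nbhd_fubini:
  assumes F: "ultrafilter F" and d: "ultrafilter d" "nonprincipal d"
  shows "tukey_below (nbhd_order F beta_omega) (nbhd_order (fubini F d) omega_star)"
proof -
  define cyl where "cyl A = {x. fst (prod_decode x) \<in> A}" for A
  have col: "column (cyl A) n = (if n \<in> A then UNIV else {})" for A n
    by (auto simp: cyl_def column_def)
  have np: "nonprincipal (fubini F d)" using F d by (rule nonprincipal_fubini)
  have uf: "ultrafilter (fubini F d)" using F d(1) by (rule ultrafilter_fubini)
  have dbot: "d \<noteq> bot" using d by (simp add: ultrafilter_def)
  have "\<forall>N\<in>Nbhd F beta_omega. \<exists>A. F \<in> stone_basic A \<and> stone_basic A \<subseteq> N"
    by (simp add: Nbhd_beta_omega)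
  then obtain A where A: "\<And>N. N \<in> Nbhd F beta_omega \<Longrightarrow> F \<in> stone_basic (A N)"
    "\<And>N. N \<in> Nbhd F beta_omega \<Longrightarrow> stone_basic (A N) \<subseteq> N" by metis
  define f where "f N = stone_basic (cyl (A N)) \<inter> Collect nonprincipal" for N
  have f: "f N \<in> Nbhd (fubini F d) omega_star" if "N \<in> Nbhd F beta_omega" for N
  proof -
    have "eventually (\<lambda>n. n \<in> A N) F" using A(1)[OF that] by (simp add: stone_basic_def)
    then have "eventually (\<lambda>x. x \<in> cyl (A N)) (fubini F d)"
      unfolding fubini_mem col by eventually_elim simp
    then have "fubini F d \<in> stone_basic (cyl (A N))" by (simp add: stone_basic_def uf)
    then show ?thesis
      unfolding f_def by (rule stone_basic_in_Nbhd_omega_star[OF np])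
  qed
  have "\<exists>K\<in>Nbhd F beta_omega. \<forall>N\<in>Nbhd F beta_omega. M \<subseteq> f N \<longrightarrow> K \<subseteq> N"
    if M: "M \<in> Nbhd (fubini F d) omega_star" for M
  proof -
    obtain B where B: "fubini F d \<in> stone_basic B" "stone_basic B \<inter> Collect nonprincipal \<subseteq> M"
      using M Nbhd_omega_star[OF np] by blast
    define S where "S = {n. eventually (\<lambda>m. m \<in> column B n) d}"
    have "F \<in> stone_basic S"
      using B(1) F by (simp add: stone_basic_def fubini_mem S_def)
    then have "stone_basic S \<in> Nbhd F beta_omega" by (rule stone_basic_in_Nbhd_beta_omega)
    moreover have "stone_basic S \<subseteq> N" if N: "N \<in> Nbhd F beta_omega" "M \<subseteq> f N" for N
    proof -
      have "S \<subseteq> A N"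
      proof
        fix n assume n: "n \<in> S"
        have pu: "ultrafilter (fubini (principal {n}) d)"
          by (rule ultrafilter_fubini[OF ultrafilter_principal d(1)])
        have pn: "nonprincipal (fubini (principal {n}) d)"
          by (rule nonprincipal_fubini[OF ultrafilter_principal d])
        have "fubini (principal {n}) d \<in> stone_basic B"
          using n pu by (simp add: stone_basic_def fubini_mem eventually_principal S_def)
        then have "fubini (principal {n}) d \<in> f N" using pn B(2) N(2) by blast
        then have "eventually (\<lambda>m. m \<in> column (cyl (A N)) n) d"
          by (simp add: f_def stone_basic_def fubini_mem eventually_principal)
        then show "n \<in> A N" using dbot by (auto simp: col trivial_limit_def split: if_splits)
      qed
      then show ?thesis using A(2)[OF N(1)] stone_basic_subset_iff by blast
    qed
    ultimately show ?thesis by blast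
  qed
  then show ?thesis
    unfolding tukey_below_def Field_nbhd_order
    by (intro exI[of _ f]) (simp add: nbhd_order_def f)
qed

text \<open>A member \<open>B\<close> of the sum determines the set \<open>s\<close> of indices whose column belongs to \<open>d\<close>, and a
  set \<open>c\<close> all of whose columns belong to \<open>d\<close>, obtained by filling up the other columns of \<open>B\<close>. The
  reduction intersects \<open>s\<close> with the image of \<open>c\<close> under a reduction \<open>h\<close> of the column filter to \<open>F\<close>.
  If this intersection includes \<open>A\<close>, then \<open>c\<close> almost includes a set \<open>D\<close> depending on \<open>A\<close> only, and
  \<open>D \<inter> (A \<times> \<omega>)\<close> is almost included in \<open>c \<inter> (s \<times> \<omega>)\<close>, hence in \<open>B\<close>.\<close>

lemma tukey_below_fubini_nbhd:
  assumes CH and F: "ultrafilter F" "nonprincipal F" and d: "p_point d"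
  shows "tukey_below (nbhd_order (fubini F d) omega_star) (nbhd_order F beta_omega)"
proof -
  have du: "ultrafilter d" and dn: "nonprincipal d" using d by (auto simp: p_point_def)
  have np: "nonprincipal (fubini F d)" using F(1) du dn by (rule nonprincipal_fubini)
  have uf: "ultrafilter (fubini F d)" using F(1) du by (rule ultrafilter_fubini)
  define \<C> where "\<C> = {C. \<forall>n. eventually (\<lambda>m. m \<in> column C n) d}"
  define P where "P = {(C, D). C \<in> \<C> \<and> D \<in> \<C> \<and> finite (D - C)}"
  define Q where "Q = {(A, B). eventually (\<lambda>n. n \<in> A) F \<and> eventually (\<lambda>n. n \<in> B) F \<and> B \<subseteq> A}"
  have P: "(C, D) \<in> P \<longleftrightarrow> C \<in> \<C> \<and> D \<in> \<C> \<and> finite (D - C)" for C D by (simp add: P_def)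
  have Q: "(A, B) \<in> Q \<longleftrightarrow> eventually (\<lambda>n. n \<in> A) F \<and> eventually (\<lambda>n. n \<in> B) F \<and> B \<subseteq> A" for A B
    by (simp add: Q_def)
  have FP: "Field P = \<C>" by (auto simp: P_def Field_def)
  have FQ: "Field Q = {A. eventually (\<lambda>n. n \<in> A) F}" by (auto simp: Q_def Field_def)
  obtain r :: "nat set rel" where tot: "\<And>X Y. (X, Y) \<in> r \<or> (Y, X) \<in> r"
    and cs: "\<And>X. countable {Y. (Y, X) \<in> r}"
    by (rule CH_well_order_countable_segments[OF assms(1)]) (rule that)
  have "tukey_below P Q"
  proof (rule tukey_below_of_countable_segments[OF tot cs])
    fix S assume S: "S \<subseteq> Field P" "countable S"
    then obtain D where "D \<in> \<C>" "\<forall>C\<in>S. finite (D - C)"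
      using column_filter_countably_directed[OF d, of S] by (auto simp: FP \<C>_def)
    then show "\<exists>D\<in>Field P. \<forall>C\<in>S. (C, D) \<in> P" using S(1) unfolding FP P by blast
  next
    fix S assume S: "S \<subseteq> Field Q" "countable S"
    then obtain B where "eventually (\<lambda>n. n \<in> B) F" "\<forall>A\<in>S. \<not> A \<subseteq> B"
      using nonprincipal_ultrafilter_no_countable_base[OF F, of S] by (auto simp: FQ)
    then show "\<exists>B\<in>Field Q. \<forall>A\<in>S. (B, A) \<notin> Q" unfolding FQ Q by blast
  qed
  then obtain h where hFQ: "\<forall>C\<in>Field P. h C \<in> Field Q"
    and h_bound: "\<forall>A\<in>Field Q. \<exists>D\<in>Field P. \<forall>C\<in>Field P. (h C, A) \<in> Q \<longrightarrow> (C, D) \<in> P"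
    unfolding tukey_below_def by blast
  have h: "eventually (\<lambda>n. n \<in> h C) F" if "C \<in> \<C>" for C
    using hFQ that unfolding FP FQ by blast
  have hb: "\<exists>D\<in>\<C>. \<forall>C\<in>\<C>. A \<subseteq> h C \<longrightarrow> finite (D - C)" if A: "eventually (\<lambda>n. n \<in> A) F" for A
  proof -
    have "A \<in> Field Q" using A by (simp add: FQ)
    then obtain D where D: "D \<in> \<C>" "\<forall>C\<in>\<C>. (h C, A) \<in> Q \<longrightarrow> (C, D) \<in> P"
      using h_bound unfolding FP by blast
    have "finite (D - C)" if "C \<in> \<C>" "A \<subseteq> h C" for C
    proof -
      have "(h C, A) \<in> Q" unfolding Q using h[OF that(1)] A that(2) by blast
      then have "(C, D) \<in> P" using D(2) that(1) by blast
      then show ?thesis unfolding P by blast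
    qed
    then show ?thesis using D(1) by blast
  qed
  have "\<forall>N\<in>Nbhd (fubini F d) omega_star.
      \<exists>B. fubini F d \<in> stone_basic B \<and> stone_basic B \<inter> Collect nonprincipal \<subseteq> N"
    by (simp add: Nbhd_omega_star[OF np])
  then obtain B where B: "\<And>N. N \<in> Nbhd (fubini F d) omega_star \<Longrightarrow> fubini F d \<in> stone_basic (B N)"
    "\<And>N. N \<in> Nbhd (fubini F d) omega_star \<Longrightarrow> stone_basic (B N) \<inter> Collect nonprincipal \<subseteq> N"
    by metis
  define s where "s N = {n. eventually (\<lambda>m. m \<in> column (B N) n) d}" for N
  define c where "c N = B N \<union> {x. fst (prod_decode x) \<notin> s N}" for N
  have s: "eventually (\<lambda>n. n \<in> s N) F" if "N \<in> Nbhd (fubini F d) omega_star" for N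
    using B(1)[OF that] by (simp add: stone_basic_def fubini_mem s_def)
  have c: "c N \<in> \<C>" for N
    unfolding \<C>_def mem_Collect_eq
  proof
    fix n
    show "eventually (\<lambda>m. m \<in> column (c N) n) d"
      by (cases "n \<in> s N") (auto simp: c_def s_def column_def)
  qed
  define f where "f N = stone_basic (s N \<inter> h (c N))" for N
  have f: "f N \<in> Nbhd F beta_omega" if "N \<in> Nbhd (fubini F d) omega_star" for N
  proof -
    have "F \<in> stone_basic (s N \<inter> h (c N))"
      using s[OF that] h[OF c[of N]] F(1) by (simp add: stone_basic_def eventually_conj)
    then show ?thesis
      unfolding f_def by (rule stone_basic_in_Nbhd_beta_omega)
  qed
  have "\<exists>K\<in>Nbhd (fubini F d) omega_star. \<forall>N\<in>Nbhd (fubini F d) omega_star. M \<subseteq> f N \<longrightarrow> K \<subseteq> N"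
    if M: "M \<in> Nbhd F beta_omega" for M
  proof -
    obtain A where A: "F \<in> stone_basic A" "stone_basic A \<subseteq> M" using M Nbhd_beta_omega by blast
    have evA: "eventually (\<lambda>n. n \<in> A) F" using A(1) by (simp add: stone_basic_def)
    then obtain D where D: "D \<in> \<C>" "\<And>C. C \<in> \<C> \<Longrightarrow> A \<subseteq> h C \<Longrightarrow> finite (D - C)"
      using hb by blast
    define E where "E = D \<inter> {x. fst (prod_decode x) \<in> A}"
    have "eventually (\<lambda>n. eventually (\<lambda>m. m \<in> column E n) d) F"
      using evA D(1) by (auto simp: E_def column_def \<C>_def elim!: eventually_mono)
    then have E: "fubini F d \<in> stone_basic E" using uf by (simp add: stone_basic_def fubini_mem)
    let ?K = "stone_basic E \<inter> Collect nonprincipal"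
    have "?K \<in> Nbhd (fubini F d) omega_star" using np E by (rule stone_basic_in_Nbhd_omega_star)
    moreover have "?K \<subseteq> N" if N: "N \<in> Nbhd (fubini F d) omega_star" "M \<subseteq> f N" for N
    proof -
      have "A \<subseteq> s N \<inter> h (c N)"
        using A(2) N(2) unfolding f_def stone_basic_subset_iff[symmetric] by blast
      then have "finite (D - c N)" and sub: "A \<subseteq> s N" using D(2)[OF c] by auto
      moreover have "E - B N \<subseteq> D - c N" using sub by (auto simp: E_def c_def)
      ultimately have fin: "finite (E - B N)" by (meson finite_subset)
      have "?K \<subseteq> stone_basic (B N)"
        using nonprincipal_ultrafilter_mod_finite[OF _ _ _ fin] by (auto simp: stone_basic_def)
      then show ?thesis using B(2)[OF N(1)] by blast
    qed
    ultimately show ?thesis by blast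
  qed
  then show ?thesis
    unfolding tukey_below_def Field_nbhd_order
    by (intro exI[of _ f]) (simp add: nbhd_order_def f)
qed

theorem lemma4p9:
  fixes \<U> :: "nat filter"
  assumes "CH" and "ultrafilter \<U>" and "nonprincipal \<U>"
  shows "\<exists>p \<in> topspace omega_star.
    cofinally_equivalent (nbhd_order \<U> beta_omega) (nbhd_order p omega_star)"
proof -
  obtain d :: "nat filter" where d: "p_point d" using CH_p_point_exists[OF assms(1)] .
  then have du: "ultrafilter d" "nonprincipal d" by (auto simp: p_point_def)
  show ?thesis
  proof (rule bexI)
    show "fubini \<U> d \<in> topspace omega_star"
      using ultrafilter_fubini nonprincipal_fubini assms du by (simp add: topspace_omega_star)
    show "cofinally_equivalent (nbhd_order \<U> beta_omega) (nbhd_order (fubini \<U> d) omega_star)"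
      using tukey_below_nbhd_fubini[OF assms(2) du] tukey_below_fubini_nbhd[OF assms d]
      by (intro tukey_equivalent_imp_cofinally_equivalent Preorder_nbhd_order directed_nbhd_order)
  qed
qed

end
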